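(* Let $A\in\mathbb{R}^{n\times n}$, $B\in\mathbb{R}^{m\times m}$, $C_1\in\mathbb{R}^{n\times s}$, $C_2\in\mathbb{R}^{m\times s}$, and let $N\ge 1$. Suppose that block Krylov bases $\mathcal{V}_j,\mathcal{W}_j$ ($1\le j\le 2N+1$) and block matrices $\mathcal{H}_{j+1,j},\mathcal{G}_{j+1,j}$ ($1\le j\le 2N$) as described in the context are given, and that the matrix-oriented BiCGSTAB iteration with $X_0=O_{n,m}$ and $\tilde{R}_0=R_0$ can be carried out for $k=0,\ldots,N-1$ without division by zero. Then the factorized BiCGSTAB iteration can also be carried out for $k=0,\ldots,N-1$ without division by zero, it produces the same scalars $\alpha_k,\omega_k,\beta_k$ ($0\le k\le N-1$) and $\rho_k$ ($0\le k\le N$) as the matrix-oriented BiCGSTAB iteration, and $$X_k=\mathcal{V}_{2k}\mathbf{X}_k\mathcal{W}_{2k}^\top,\quad R_k=\mathcal{V}_{2k+1}\mathbf{R}_k\mathcal{W}_{2k+1}^\top,\quad P_k=\mathcal{V}_{2k+1}\mathbf{P}_k\mathcal{W}_{2k+1}^\top\qquad(0\le k\le N),$$ $$Q_k=\mathcal{V}_{2k+2}\mathbf{Q}_k\mathcal{W}_{2k+2}^\top,\quad S_k=\mathcal{V}_{2k+2}\mathbf{S}_k\mathcal{W}_{2k+2}^\top,\quad T_k=\mathcal{V}_{2k+3}\mathbf{T}_k\mathcal{W}_{2k+3}^\top\qquad(0\le k\le N-1),$$ where for $k=0$ the first identity is read as $X_0=O_{n,m}$. Moreover $\|R_k\|=\|\mathbf{R}_k\|$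 for $0\le k\le N$, so the two methods have the same relative residual norms.
   Context: $\langle X,Y\rangle:=\mathrm{tr}(X^\top Y)$, $\|\cdot\|$ is the Frobenius norm, $O_{p,q}$ is the $p\times q$ zero matrix, and $M(1:i,1:j)$ is the upper-left $i\times j$ submatrix of $M$. The equation to be solved is the Sylvester equation $AX+XB=C_1C_2^\top$ for $X\in\mathbb{R}^{n\times m}$. Matrix-oriented BiCGSTAB (with $X_0=O_{n,m}$, $\tilde R_0=R_0$): $R_0=C_1C_2^\top$, $P_0=R_0$, $\rho_0=\langle R_0,\tilde R_0\rangle$, and for $k=0,1,2,\ldots$: $Q_k=AP_k+P_kB$; $\alpha_k=\rho_k/\langle\tilde R_0,Q_k\rangle$; $S_k=R_k-\alpha_kQ_k$; $T_k=AS_k+S_kB$; $\omega_k=\langle T_k,S_k\rangle/\langle T_k,T_k\rangle$; $X_{k+1}=X_k+\alpha_kP_k+\omega_kS_k$; $R_{k+1}=S_k-\omega_kT_k$; $\rho_{k+1}=\langle R_{k+1},\tilde R_0\rangle$; $\beta_k=(\alpha_k/\omega_k)\cdot(\rho_{k+1}/\rho_k)$; $P_{k+1}=R_{k+1}+\beta_k(P_k-\omega_kQ_k)$. Block Krylov bases (as produced by the block Arnoldi process): $C_1=V_1R_{\mathrm L}$ and $C_2=W_1R_{\mathrm R}$ are QR factorizations with $V_1\in\mathbb{R}^{n\times s}$, $W_1\in\mathbb{R}^{m\times s}$ column-orthonormal and $R_{\mathrm L},R_{\mathrm R}\in\mathbb{R}^{s\times s}$; $\mathcal{V}_j=[V_1,\ldots,V_j]\in\mathbb{R}^{n\times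 js}$ and $\mathcal{W}_j=[W_1,\ldots,W_j]\in\mathbb{R}^{m\times js}$ have orthonormal columns; and $\mathcal{H}_{j+1,j},\mathcal{G}_{j+1,j}\in\mathbb{R}^{(j+1)s\times js}$ are block Hessenberg matrices satisfying $A\mathcal{V}_j=\mathcal{V}_{j+1}\mathcal{H}_{j+1,j}$ and $B^\top\mathcal{W}_j=\mathcal{W}_{j+1}\mathcal{G}_{j+1,j}$. Factorized BiCGSTAB: $\mathbf{X}_0$ is the empty matrix, $\mathbf{R}_0=R_{\mathrm L}R_{\mathrm R}^\top$, $\mathbf{P}_0=\mathbf{R}_0$, $\tilde{\mathbf{R}}_0=\mathbf{R}_0$, $\rho_0=\langle\tilde{\mathbf{R}}_0,\mathbf{R}_0\rangle$, and for $k=0,1,2,\ldots$: $\mathbf{Q}_k=[\mathcal{H}_{2k+2,2k+1}\mathbf{P}_k,\ O_{(2k+2)s,s}]+\begin{bmatrix}\mathbf{P}_k\mathcal{G}_{2k+2,2k+1}^\top\\O_{s,(2k+2)s}\end{bmatrix}$; $\alpha_k=\rho_k/\langle\tilde{\mathbf{R}}_0,\mathbf{Q}_k(1:s,1:s)\rangle$; $\mathbf{S}_k=\begin{bmatrix}\mathbf{R}_k&O_{(2k+1)s,s}\\O_{s,(2k+1)s}&O_{s,s}\end{bmatrix}-\alpha_k\mathbf{Q}_k$; $\mathbf{T}_k=[\mathcal{H}_{2k+3,2k+2}\mathbf{S}_k,\ O_{(2k+3)s,s}]+\begin{bmatrix}\mathbf{S}_k\mathcal{G}_{2k+3,2k+2}^\top\\O_{s,(2k+3)s}\end{bmatrix}$;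 $\omega_k=\langle\mathbf{T}_k(1:(2k+2)s,1:(2k+2)s),\mathbf{S}_k\rangle/\langle\mathbf{T}_k,\mathbf{T}_k\rangle$; $\mathbf{X}_{k+1}=\begin{bmatrix}\mathbf{X}_k&O_{2ks,2s}\\O_{2s,2ks}&O_{2s,2s}\end{bmatrix}+\begin{bmatrix}\alpha_k\mathbf{P}_k&O_{(2k+1)s,s}\\O_{s,(2k+1)s}&O_{s,s}\end{bmatrix}+\omega_k\mathbf{S}_k$; $\mathbf{R}_{k+1}=\begin{bmatrix}\mathbf{S}_k&O_{(2k+2)s,s}\\O_{s,(2k+2)s}&O_{s,s}\end{bmatrix}-\omega_k\mathbf{T}_k$; $\rho_{k+1}=\langle\tilde{\mathbf{R}}_0,\mathbf{R}_{k+1}(1:s,1:s)\rangle$; $\beta_k=(\alpha_k/\omega_k)\cdot(\rho_{k+1}/\rho_k)$; $\mathbf{P}_{k+1}=\mathbf{R}_{k+1}+\beta_k\left(\begin{bmatrix}\mathbf{P}_k&O_{(2k+1)s,2s}\\O_{2s,(2k+1)s}&O_{2s,2s}\end{bmatrix}-\omega_k\begin{bmatrix}\mathbf{Q}_k&O_{(2k+2)s,s}\\O_{s,(2k+2)s}&O_{s,s}\end{bmatrix}\right)$. Here $\mathbf{X}_k\in\mathbb{R}^{2ks\times 2ks}$, $\mathbf{R}_k,\mathbf{P}_k\in\mathbb{R}^{(2k+1)s\times(2k+1)s}$, $\mathbf{Q}_k,\mathbf{S}_k\in\mathbb{R}^{(2k+2)s\times(2k+2)s}$, $\mathbf{T}_k\in\mathbb{R}^{(2k+3)s\times(2k+3)s}$.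 All computations are in exact arithmetic. *)

theory Defs
  imports Complex_Main "Jordan_Normal_Form.Matrix" "Jordan_Normal_Form.DL_Submatrix"
begin

section \<open>Matrix notions\<close>

definition mat_trace :: "real mat \<Rightarrow> real" where
  "mat_trace M = (\<Sum>i<dim_row M. M $$ (i, i))"

definition frob_inner :: "real mat \<Rightarrow> real mat \<Rightarrow> real" where
  "frob_inner X Y = mat_trace (X\<^sup>T * Y)"

definition frob_norm :: "real mat \<Rightarrow> real" where
  "frob_norm X = sqrt (frob_inner X X)"

definition append_cols :: "real mat \<Rightarrow> real mat \<Rightarrow> real mat" where
  "append_cols X Y = four_block_mat X Y (0\<^sub>m 0 (dim_col X)) (0\<^sub>m 0 (dim_col Y))"

text \<open>\<open>pad r M\<close> is \<open>M\<close> bordered by \<open>r\<close> zero rows below and \<open>r\<close> zero columns to the right.\<close>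

definition pad :: "nat \<Rightarrow> real mat \<Rightarrow> real mat" where
  "pad r M = four_block_mat M (0\<^sub>m (dim_row M) r) (0\<^sub>m r (dim_col M)) (0\<^sub>m r r)"

text \<open>\<open>M(1:i,1:j)\<close>; rows and columns are indexed from 0 here.\<close>

definition upper_left :: "nat \<Rightarrow> nat \<Rightarrow> real mat \<Rightarrow> real mat" where
  "upper_left i j M = submatrix M {..<i} {..<j}"

definition block_hessenberg :: "nat \<Rightarrow> real mat \<Rightarrow> bool" where
  "block_hessenberg s M \<longleftrightarrow>
     (\<forall>i<dim_row M. \<forall>j<dim_col M. j div s + 1 < i div s \<longrightarrow> M $$ (i, j) = 0)"


section \<open>Matrix-oriented BiCGSTAB\<close>

text \<open>
  Since division on the reals is total, the sequences are defined for every \<open>k\<close>. That the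
  iteration can actually be carried out for \<open>k = 0, ..., N - 1\<close> is expressed by
  \<open>bicg_no_breakdown N\<close> below: every quantity these steps divide by (including the ones in
  the formula for beta) is nonzero. \<open>bicg_Rt\<close> is the shadow residual \<open>R_0\<close>, and
  \<open>X_0 = 0\<close>. The factorized iteration is treated in the same way.
\<close>

context
  fixes A B C1 C2 :: "real mat"
begin

definition bicg_Rt :: "real mat" where
  "bicg_Rt = C1 * C2\<^sup>T"

function bicg_X :: "nat \<Rightarrow> real mat" and bicg_R :: "nat \<Rightarrow> real mat"
  and bicg_P :: "nat \<Rightarrow> real mat" and bicg_Q :: "nat \<Rightarrow> real mat"
  and bicg_S :: "nat \<Rightarrow> real mat" and bicg_T :: "nat \<Rightarrow> real mat"
  and bicg_alpha :: "nat \<Rightarrow> real" and bicg_omega :: "nat \<Rightarrow> real"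
  and bicg_beta :: "nat \<Rightarrow> real" and bicg_rho :: "nat \<Rightarrow> real"
where
  "bicg_X 0 = 0\<^sub>m (dim_row A) (dim_row B)"
| "bicg_X (Suc k) = bicg_X k + bicg_alpha k \<cdot>\<^sub>m bicg_P k + bicg_omega k \<cdot>\<^sub>m bicg_S k"
| "bicg_R 0 = C1 * C2\<^sup>T"
| "bicg_R (Suc k) = bicg_S k - bicg_omega k \<cdot>\<^sub>m bicg_T k"
| "bicg_P 0 = bicg_R 0"
| "bicg_P (Suc k) =
     bicg_R (Suc k) + bicg_beta k \<cdot>\<^sub>m (bicg_P k - bicg_omega k \<cdot>\<^sub>m bicg_Q k)"
| "bicg_Q k = A * bicg_P k + bicg_P k * B"
| "bicg_S k = bicg_R k - bicg_alpha k \<cdot>\<^sub>m bicg_Q k"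
| "bicg_T k = A * bicg_S k + bicg_S k * B"
| "bicg_alpha k = bicg_rho k / frob_inner bicg_Rt (bicg_Q k)"
| "bicg_omega k = frob_inner (bicg_T k) (bicg_S k) / frob_inner (bicg_T k) (bicg_T k)"
| "bicg_beta k = (bicg_alpha k / bicg_omega k) * (bicg_rho (Suc k) / bicg_rho k)"
| "bicg_rho k = frob_inner (bicg_R k) bicg_Rt"
  by pat_completeness auto
termination
  by (relation "measure (\<lambda>x. case x of
        Inl (Inl (Inl k)) \<Rightarrow> 20 * k
      | Inl (Inl (Inr k)) \<Rightarrow> 20 * k + 1
      | Inl (Inr (Inl k)) \<Rightarrow> 20 * k + 5
      | Inl (Inr (Inr (Inl k))) \<Rightarrow> 20 * k + 6
      | Inl (Inr (Inr (Inr k))) \<Rightarrow> 20 * k + 8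
      | Inr (Inl (Inl k)) \<Rightarrow> 20 * k + 9
      | Inr (Inl (Inr k)) \<Rightarrow> 20 * k + 7
      | Inr (Inr (Inl k)) \<Rightarrow> 20 * k + 10
      | Inr (Inr (Inr (Inl k))) \<Rightarrow> 20 * k + 23
      | Inr (Inr (Inr (Inr k))) \<Rightarrow> 20 * k + 2)") auto

definition bicg_no_breakdown :: "nat \<Rightarrow> bool" where
  "bicg_no_breakdown N \<longleftrightarrow>
     (\<forall>k<N. frob_inner bicg_Rt (bicg_Q k) \<noteq> 0 \<and> frob_inner (bicg_T k) (bicg_T k) \<noteq> 0
        \<and> bicg_omega k \<noteq> 0 \<and> bicg_rho k \<noteq> 0)"

end


section \<open>Block Krylov bases\<close>

text \<open>\<open>block_row n V j\<close> is the \<open>n\<close>-row matrix \<open>[V 1, ..., V j]\<close>.\<close>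

primrec block_row :: "nat \<Rightarrow> (nat \<Rightarrow> real mat) \<Rightarrow> nat \<Rightarrow> real mat" where
  "block_row n V 0 = 0\<^sub>m n 0"
| "block_row n V (Suc j) = append_cols (block_row n V j) (V (Suc j))"

text \<open>
  \<open>H j\<close> stands for the \<open>(j+1)s \<times> js\<close> matrix with double index \<open>j+1,j\<close>. The basis
  blocks \<open>V 1, ..., V (J + 1)\<close> and the matrices \<open>H 1, ..., H J\<close> are constrained; for
  the right-hand basis the predicate is used with \<open>B\<^sup>T\<close> and \<open>C2\<close>.
\<close>

definition block_krylov ::
  "nat \<Rightarrow> nat \<Rightarrow> nat \<Rightarrow> real mat \<Rightarrow> real mat \<Rightarrow> (nat \<Rightarrow> real mat) \<Rightarrow> real mat
     \<Rightarrow> (nat \<Rightarrow> real mat) \<Rightarrow> bool" where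
  "block_krylov n s J A C V R H \<longleftrightarrow>
     R \<in> carrier_mat s s \<and> upper_triangular R \<and> C = V 1 * R \<and>
     (\<forall>j\<in>{1..J + 1}. V j \<in> carrier_mat n s \<and>
        (block_row n V j)\<^sup>T * block_row n V j = 1\<^sub>m (j * s)) \<and>
     (\<forall>j\<in>{1..J}. H j \<in> carrier_mat ((j + 1) * s) (j * s) \<and> block_hessenberg s (H j) \<and>
        A * block_row n V j = block_row n V (j + 1) * H j)"


section \<open>Factorized BiCGSTAB\<close>

context
  fixes s :: nat and RL RR :: "real mat" and H G :: "nat \<Rightarrow> real mat"
begin

definition fact_Rt :: "real mat" where
  "fact_Rt = RL * RR\<^sup>T"

function fact_X :: "nat \<Rightarrow> real mat" and fact_R :: "nat \<Rightarrow> real mat"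
  and fact_P :: "nat \<Rightarrow> real mat" and fact_Q :: "nat \<Rightarrow> real mat"
  and fact_S :: "nat \<Rightarrow> real mat" and fact_T :: "nat \<Rightarrow> real mat"
  and fact_alpha :: "nat \<Rightarrow> real" and fact_omega :: "nat \<Rightarrow> real"
  and fact_beta :: "nat \<Rightarrow> real" and fact_rho :: "nat \<Rightarrow> real"
where
  "fact_X 0 = 0\<^sub>m 0 0"
| "fact_X (Suc k) =
     pad (2 * s) (fact_X k) + pad s (fact_alpha k \<cdot>\<^sub>m fact_P k) + fact_omega k \<cdot>\<^sub>m fact_S k"
| "fact_R 0 = RL * RR\<^sup>T"
| "fact_R (Suc k) = pad s (fact_S k) - fact_omega k \<cdot>\<^sub>m fact_T k"
| "fact_P 0 = fact_R 0"
| "fact_P (Suc k) =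
     fact_R (Suc k)
       + fact_beta k \<cdot>\<^sub>m (pad (2 * s) (fact_P k) - fact_omega k \<cdot>\<^sub>m pad s (fact_Q k))"
| "fact_Q k =
     append_cols (H (2 * k + 1) * fact_P k) (0\<^sub>m ((2 * k + 2) * s) s)
       + ((fact_P k * (G (2 * k + 1))\<^sup>T) @\<^sub>r 0\<^sub>m s ((2 * k + 2) * s))"
| "fact_S k = pad s (fact_R k) - fact_alpha k \<cdot>\<^sub>m fact_Q k"
| "fact_T k =
     append_cols (H (2 * k + 2) * fact_S k) (0\<^sub>m ((2 * k + 3) * s) s)
       + ((fact_S k * (G (2 * k + 2))\<^sup>T) @\<^sub>r 0\<^sub>m s ((2 * k + 3) * s))"
| "fact_alpha k = fact_rho k / frob_inner fact_Rt (upper_left s s (fact_Q k))"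
| "fact_omega k =
     frob_inner (upper_left ((2 * k + 2) * s) ((2 * k + 2) * s) (fact_T k)) (fact_S k)
       / frob_inner (fact_T k) (fact_T k)"
| "fact_beta k = (fact_alpha k / fact_omega k) * (fact_rho (Suc k) / fact_rho k)"
| "fact_rho 0 = frob_inner fact_Rt (fact_R 0)"
| "fact_rho (Suc k) = frob_inner fact_Rt (upper_left s s (fact_R (Suc k)))"
  by pat_completeness auto
termination
  by (relation "measure (\<lambda>x. case x of
        Inl (Inl (Inl k)) \<Rightarrow> 20 * k
      | Inl (Inl (Inr k)) \<Rightarrow> 20 * k + 1
      | Inl (Inr (Inl k)) \<Rightarrow> 20 * k + 5
      | Inl (Inr (Inr (Inl k))) \<Rightarrow> 20 * k + 6
      | Inl (Inr (Inr (Inr k))) \<Rightarrow> 20 * k + 8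
      | Inr (Inl (Inl k)) \<Rightarrow> 20 * k + 9
      | Inr (Inl (Inr k)) \<Rightarrow> 20 * k + 7
      | Inr (Inr (Inl k)) \<Rightarrow> 20 * k + 10
      | Inr (Inr (Inr (Inl k))) \<Rightarrow> 20 * k + 23
      | Inr (Inr (Inr (Inr k))) \<Rightarrow> 20 * k + 2)") auto

definition fact_no_breakdown :: "nat \<Rightarrow> bool" where
  "fact_no_breakdown N \<longleftrightarrow>
     (\<forall>k<N. frob_inner fact_Rt (upper_left s s (fact_Q k)) \<noteq> 0
        \<and> frob_inner (fact_T k) (fact_T k) \<noteq> 0 \<and> fact_omega k \<noteq> 0 \<and> fact_rho k \<noteq> 0)"

end

end

theory Submission
  imports Defs
begin

text \<open>
  The factorized iteration is the matrix-oriented one written in coordinates. Let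
  \<open>lift j M = \<V>\<^sub>j M \<W>\<^sub>j\<^sup>T\<close>, where \<open>\<V>\<^sub>j\<close> and \<open>\<W>\<^sub>j\<close> are the block
  Krylov bases. Three facts about this linear map carry the proof.

  \<^item> Bordering a coordinate matrix by zeros does not change the matrix it stands for
    (\<open>lift_pad\<close>). So iterates that live in bases of different sizes can be combined once the
    smaller ones are padded.
  \<^item> The Arnoldi relations turn the Sylvester operator \<open>Y \<mapsto> A Y + Y B\<close> into the
    Hessenberg expression of the factorized method, at the price of one more basis block
    (\<open>lift_sylvester\<close>). Each iteration applies the operator twice, hence the sizes
    \<open>2k + 1\<close>, \<open>2k + 2\<close>, \<open>2k + 3\<close>.
  \<^item> Since the bases have orthonormal columns, \<open>lift j\<close> preserves the Frobenius inner product
    (\<open>frob_inner_lift\<close>). Against a lift from a smaller basis, only the upper-left block of the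
    other argument contributes (\<open>frob_inner_lift_pad\<close>).

  The third fact makes every scalar of the two methods agree as long as the matrices correspond;
  the first two make the matrices correspond as long as the scalars agree. One induction on
  \<open>k\<close> proves both. The quotients have equal denominators, so neither method breaks down
  before the other does, and the isometry gives the equality of residual norms.
\<close>

section \<open>Block matrices bordered by zeros\<close>

lemma append_cols_carrier:
  assumes "X \<in> carrier_mat n p" "Y \<in> carrier_mat n q"
  shows "append_cols X Y \<in> carrier_mat n (p + q)"
  using assms unfolding append_cols_def carrier_mat_def by auto

lemma append_cols_mult_append_rows_zero:
  assumes X: "X \<in> carrier_mat n p" and Y: "Y \<in> carrier_mat n q" and M: "M \<in> carrier_mat p r"
  shows "append_cols X Y * (M @\<^sub>r 0\<^sub>m q r) = X * M"
proof -
  have "append_cols X Y * (M @\<^sub>r 0\<^sub>m q r)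
      = four_block_mat X Y (0\<^sub>m 0 p) (0\<^sub>m 0 q) * four_block_mat M (0\<^sub>m p 0) (0\<^sub>m q r) (0\<^sub>m q 0)"
    using X Y M unfolding append_cols_def append_rows_def by auto
  also have "\<dots> = four_block_mat (X * M + Y * 0\<^sub>m q r) (X * 0\<^sub>m p 0 + Y * 0\<^sub>m q 0)
      (0\<^sub>m 0 p * M + 0\<^sub>m 0 q * 0\<^sub>m q r) (0\<^sub>m 0 p * 0\<^sub>m p 0 + 0\<^sub>m 0 q * 0\<^sub>m q 0)"
    by (rule mult_four_block_mat[OF X Y _ _ M]) auto
  also have "\<dots> = X * M"
    using X Y M by (intro eq_matI) auto
  finally show ?thesis .
qed

lemma transpose_append_cols:
  assumes "X \<in> carrier_mat n p" "Y \<in> carrier_mat n q"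
  shows "(append_cols X Y)\<^sup>T = X\<^sup>T @\<^sub>r Y\<^sup>T"
  using assms unfolding append_cols_def append_rows_def
  by (subst transpose_four_block_mat[of _ n p _ q _ 0]) auto

text \<open>
  This is the transpose of \<open>append_cols_mult_append_rows_zero\<close>, so the two cover zero blocks on either side of
  \<open>\<V> M \<W>\<^sup>T\<close>.
\<close>

lemma append_cols_zero_mult_transpose:
  assumes X: "X \<in> carrier_mat n p" and Y: "Y \<in> carrier_mat n q" and M: "M \<in> carrier_mat r p"
  shows "append_cols M (0\<^sub>m r q) * (append_cols X Y)\<^sup>T = M * X\<^sup>T"
proof -
  have Mt: "(append_cols M (0\<^sub>m r q))\<^sup>T = M\<^sup>T @\<^sub>r 0\<^sub>m q r"
    using M by (simp add: transpose_append_cols[of _ r p _ q])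
  have "(append_cols M (0\<^sub>m r q) * (append_cols X Y)\<^sup>T)\<^sup>T
      = append_cols X Y * (append_cols M (0\<^sub>m r q))\<^sup>T"
    using append_cols_carrier[OF X Y] append_cols_carrier[OF M zero_carrier_mat[of r q]]
    by (subst transpose_mult) auto
  also have "\<dots> = X * M\<^sup>T"
    unfolding Mt using X Y M by (intro append_cols_mult_append_rows_zero) auto
  also have "\<dots> = (M * X\<^sup>T)\<^sup>T"
    using X M by (subst transpose_mult) auto
  finally show ?thesis
    by (simp only: transpose_mat_eq)
qed

lemma pad_carrier: "M \<in> carrier_mat p q \<Longrightarrow> pad r M \<in> carrier_mat (p + r) (q + r)"
  unfolding pad_def by (intro four_block_carrier_mat) auto

text \<open>
  Splitting a border into zero columns followed by zero rows lets the two product rules above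
  remove it in two steps, one basis at a time.
\<close>

lemma pad_eq_append:
  assumes "M \<in> carrier_mat p q"
  shows "pad r M = append_cols M (0\<^sub>m p r) @\<^sub>r 0\<^sub>m r (q + r)"
  using assms unfolding pad_def append_cols_def append_rows_def by (intro eq_matI) auto

lemma pad_pad: "pad a (pad b M) = pad (a + b) M"
  unfolding pad_def by (intro eq_matI) auto

lemma pad_0: "pad 0 M = M"
  by (rule eq_matI) (simp_all add: pad_def)

section \<open>The Frobenius inner product\<close>

lemma frob_inner_sum:
  assumes "X \<in> carrier_mat p q" "Y \<in> carrier_mat p q"
  shows "frob_inner X Y = (\<Sum>i<p. \<Sum>j<q. X $$ (i, j) * Y $$ (i, j))"
proof -
  have "frob_inner X Y = (\<Sum>j<q. \<Sum>i<p. X $$ (i, j) * Y $$ (i, j))"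
    using assms unfolding frob_inner_def mat_trace_def
    by (auto simp: scalar_prod_def atLeast0LessThan intro!: sum.cong)
  also have "\<dots> = (\<Sum>i<p. \<Sum>j<q. X $$ (i, j) * Y $$ (i, j))"
    by (rule sum.swap)
  finally show ?thesis .
qed

lemma frob_inner_comm:
  assumes "X \<in> carrier_mat p q" "Y \<in> carrier_mat p q"
  shows "frob_inner X Y = frob_inner Y X"
  using assms by (simp add: frob_inner_sum mult.commute)

lemma upper_left_index:
  assumes M: "M \<in> carrier_mat p q" and le: "i \<le> p" "j \<le> q"
  shows "upper_left i j M \<in> carrier_mat i j"
    and "\<And>a b. a < i \<Longrightarrow> b < j \<Longrightarrow> upper_left i j M $$ (a, b) = M $$ (a, b)"
proof -
  have set_eq: "{a. a < p \<and> a \<in> {..<i}} = {..<i}" "{a. a < q \<and> a \<in> {..<j}} = {..<j}"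
    using le by auto
  have pick_id: "pick {..<l} a = a" if "a < l" for a l :: nat
  proof -
    have "{x \<in> {..<l}. x < a} = {..<a}" using that by auto
    with pick_card_in_set[of a "{..<l}"] that show ?thesis by simp
  qed
  show "upper_left i j M \<in> carrier_mat i j"
    using M set_eq unfolding upper_left_def by (intro carrier_matI) (simp_all add: dim_submatrix)
  show "upper_left i j M $$ (a, b) = M $$ (a, b)" if "a < i" "b < j" for a b
    unfolding upper_left_def using M that set_eq
    by (subst submatrix_index) (simp_all add: pick_id)
qed

text \<open>
  Padding and taking the upper-left block are adjoint to each other. This is why the factorized
  method may evaluate inner products on truncated matrices.
\<close>

lemma frob_inner_pad:
  assumes M: "M \<in> carrier_mat p q" and Y: "Y \<in> carrier_mat (p + r) (q + r)"
  shows "frob_inner Y (pad r M) = frob_inner (upper_left p q Y) M"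
proof -
  have idx: "pad r M $$ (i, j) = (if i < p \<and> j < q then M $$ (i, j) else 0)"
    if "i < p + r" "j < q + r" for i j
    using M that unfolding pad_def by auto
  have "frob_inner Y (pad r M)
      = (\<Sum>i<p + r. \<Sum>j<q + r. Y $$ (i, j) * (if i < p \<and> j < q then M $$ (i, j) else 0))"
    using Y M by (simp add: frob_inner_sum[OF Y pad_carrier[OF M]] idx)
  also have "\<dots> = (\<Sum>i<p. \<Sum>j<q. Y $$ (i, j) * M $$ (i, j))"
  proof (rule sum.mono_neutral_cong_right)
    show "(\<Sum>j<q + r. Y $$ (i, j) * (if i < p \<and> j < q then M $$ (i, j) else 0))
        = (\<Sum>j<q. Y $$ (i, j) * M $$ (i, j))" if "i \<in> {..<p}" for i
      using that by (intro sum.mono_neutral_cong_right) auto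
  qed (auto intro!: sum.neutral)
  also have "\<dots> = frob_inner (upper_left p q Y) M"
    by (subst frob_inner_sum[OF upper_left_index(1)[OF Y] M])
       (auto simp: upper_left_index(2)[OF Y])
  finally show ?thesis .
qed

text \<open>
  In the trace, \<open>V\<^sup>T V\<close> appears in the middle of the product and cancels. The
  right-hand basis is treated by the same lemma after transposition, which avoids the cyclicity of
  the trace.
\<close>

lemma frob_inner_orthonormal_left:
  assumes V: "V \<in> carrier_mat n p" and orth: "V\<^sup>T * V = 1\<^sub>m p"
    and X: "X \<in> carrier_mat p q" and Y: "Y \<in> carrier_mat p q"
  shows "frob_inner (V * X) (V * Y) = frob_inner X Y"
proof -
  have "(V * X)\<^sup>T * (V * Y) = X\<^sup>T * ((V\<^sup>T * V) * Y)"
    using V X Y by (simp add: transpose_mult[OF V X] assoc_mult_mat[of _ q p _ n _ q] assoc_mult_mat[of _ p n _ p _ q])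
  then show ?thesis
    using Y by (simp add: frob_inner_def orth)
qed

lemma frob_inner_transpose:
  assumes "X \<in> carrier_mat p q" "Y \<in> carrier_mat p q"
  shows "frob_inner X\<^sup>T Y\<^sup>T = frob_inner X Y"
proof -
  have "frob_inner X\<^sup>T Y\<^sup>T = (\<Sum>j<q. \<Sum>i<p. X $$ (i, j) * Y $$ (i, j))"
    using assms by (subst frob_inner_sum[of _ q p]) auto
  also have "\<dots> = frob_inner X Y"
    unfolding frob_inner_sum[OF assms] by (rule sum.swap)
  finally show ?thesis .
qed

section \<open>Coordinates with respect to two orthonormal bases\<close>

locale orthonormal_bases =
  fixes n m s J :: nat and V W :: "nat \<Rightarrow> real mat"
  assumes V: "\<And>j. j \<in> {1..J} \<Longrightarrow> V j \<in> carrier_mat n s \<and> (block_row n V j)\<^sup>T * block_row n V j = 1\<^sub>m (j * s)"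
    and W: "\<And>j. j \<in> {1..J} \<Longrightarrow> W j \<in> carrier_mat m s \<and> (block_row m W j)\<^sup>T * block_row m W j = 1\<^sub>m (j * s)"
begin

definition lift :: "nat \<Rightarrow> real mat \<Rightarrow> real mat" where
  "lift j M = block_row n V j * M * (block_row m W j)\<^sup>T"

lemma block_row_carrier:
  "j \<le> J \<Longrightarrow> block_row n V j \<in> carrier_mat n (j * s)"
  "j \<le> J \<Longrightarrow> block_row m W j \<in> carrier_mat m (j * s)"
proof (induction j)
  case (Suc j)
  { case 1 with Suc V[of "Suc j"] show ?case
      using append_cols_carrier[of "block_row n V j" n "j * s" "V (Suc j)" s] by (simp add: add.commute) }
  { case 2 with Suc W[of "Suc j"] show ?case
      using append_cols_carrier[of "block_row m W j" m "j * s" "W (Suc j)" s] by (simp add: add.commute) }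
qed auto

lemma lift_carrier: "j \<le> J \<Longrightarrow> M \<in> carrier_mat (j * s) (j * s) \<Longrightarrow> lift j M \<in> carrier_mat n m"
  unfolding lift_def using block_row_carrier[of j] by auto

lemma lift_add:
  assumes "j \<le> J" "M \<in> carrier_mat (j * s) (j * s)" "M' \<in> carrier_mat (j * s) (j * s)"
  shows "lift j (M + M') = lift j M + lift j M'"
  unfolding lift_def using block_row_carrier[OF assms(1)] assms
  by (simp add: mult_add_distrib_mat[of _ n "j*s" _ "j*s"] add_mult_distrib_mat[of _ n "j*s" _ _ m])

lemma lift_smult:
  assumes "j \<le> J" "M \<in> carrier_mat (j * s) (j * s)"
  shows "lift j (c \<cdot>\<^sub>m M) = c \<cdot>\<^sub>m lift j M"
  unfolding lift_def using block_row_carrier[OF assms(1)] assms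
  by (simp add: mult_smult_distrib[of _ n "j*s" _ "j*s"] mult_smult_assoc_mat[of _ n "j*s" _ m])

lemma lift_minus:
  assumes "j \<le> J" "M \<in> carrier_mat (j * s) (j * s)" "M' \<in> carrier_mat (j * s) (j * s)"
  shows "lift j (M - M') = lift j M - lift j M'"
  unfolding lift_def using block_row_carrier[OF assms(1)] assms
  by (simp add: mult_minus_distrib_mat[of _ n "j*s" _ "j*s"] minus_mult_distrib_mat[of _ n "j*s" _ _ m])

lemma lift_append_rows_zero:
  assumes j: "Suc j \<le> J" and M: "M \<in> carrier_mat (j * s) (Suc j * s)"
  shows "lift (Suc j) (M @\<^sub>r 0\<^sub>m s (Suc j * s)) = block_row n V j * M * (block_row m W (Suc j))\<^sup>T"
  unfolding lift_def
  using append_cols_mult_append_rows_zero[of "block_row n V j" n "j * s" "V (Suc j)" s M]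
    block_row_carrier(1)[of j] V[of "Suc j"] j M by simp

lemma lift_append_cols_zero:
  assumes j: "Suc j \<le> J" and M: "M \<in> carrier_mat (Suc j * s) (j * s)"
  shows "lift (Suc j) (append_cols M (0\<^sub>m (Suc j * s) s)) = block_row n V (Suc j) * M * (block_row m W j)\<^sup>T"
proof -
  have c: "append_cols M (0\<^sub>m (Suc j * s) s) \<in> carrier_mat (Suc j * s) (Suc j * s)"
    using append_cols_carrier[OF M zero_carrier_mat[of _ s]] by (simp add: add.commute)
  have "lift (Suc j) (append_cols M (0\<^sub>m (Suc j * s) s))
     = block_row n V (Suc j) * (append_cols M (0\<^sub>m (Suc j * s) s) * (block_row m W (Suc j))\<^sup>T)"
    unfolding lift_def using block_row_carrier[OF j] c
    by (intro assoc_mult_mat) auto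
  also have "\<dots> = block_row n V (Suc j) * (M * (block_row m W j)\<^sup>T)"
    using append_cols_zero_mult_transpose[of "block_row m W j" m "j * s" "W (Suc j)" s M "Suc j * s"]
      block_row_carrier(2)[of j] W[of "Suc j"] j M by simp
  also have "\<dots> = block_row n V (Suc j) * M * (block_row m W j)\<^sup>T"
    using block_row_carrier[of j] block_row_carrier[OF j] M j
    by (intro assoc_mult_mat[symmetric]) auto
  finally show ?thesis .
qed

lemma lift_pad_Suc:
  assumes j: "Suc j \<le> J" and M: "M \<in> carrier_mat (j * s) (j * s)"
  shows "lift (Suc j) (pad s M) = lift j M"
proof -
  have c: "append_cols M (0\<^sub>m (j * s) s) \<in> carrier_mat (j * s) (Suc j * s)"
    using append_cols_carrier[OF M zero_carrier_mat[of _ s]] by (simp add: add.commute)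
  have "lift (Suc j) (pad s M)
      = block_row n V j * append_cols M (0\<^sub>m (j * s) s) * (block_row m W (Suc j))\<^sup>T"
    using lift_append_rows_zero[OF j c] pad_eq_append[OF M] by (simp add: add.commute)
  also have "\<dots> = block_row n V j * (append_cols M (0\<^sub>m (j * s) s) * (block_row m W (Suc j))\<^sup>T)"
    using block_row_carrier[of j] block_row_carrier[OF j] c j by (intro assoc_mult_mat) auto
  also have "\<dots> = block_row n V j * (M * (block_row m W j)\<^sup>T)"
    using append_cols_zero_mult_transpose[of "block_row m W j" m "j * s" "W (Suc j)" s M "j * s"]
      block_row_carrier(2)[of j] W[of "Suc j"] j M by simp
  also have "\<dots> = lift j M"
    unfolding lift_def using block_row_carrier[of j] M j by (intro assoc_mult_mat[symmetric]) auto
  finally show ?thesis .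
qed

lemma lift_pad:
  assumes "j + i \<le> J" and M: "M \<in> carrier_mat (j * s) (j * s)"
  shows "lift (j + i) (pad (i * s) M) = lift j M"
  using assms(1)
proof (induction i)
  case (Suc i)
  have "pad (i * s) M \<in> carrier_mat ((j + i) * s) ((j + i) * s)"
    using pad_carrier[OF M] by (simp add: add_mult_distrib)
  from lift_pad_Suc[OF _ this] Suc show ?case by (simp add: pad_pad)
qed (simp add: pad_0)

lemma frob_inner_lift:
  assumes j: "j \<in> {1..J}" and M: "M \<in> carrier_mat (j * s) (j * s)" and M': "M' \<in> carrier_mat (j * s) (j * s)"
  shows "frob_inner (lift j M) (lift j M') = frob_inner M M'"
proof -
  let ?V = "block_row n V j" and ?W = "block_row m W j"
  have VW: "?V \<in> carrier_mat n (j * s)" "?W \<in> carrier_mat m (j * s)"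
    using block_row_carrier[of j] j by auto
  have t: "lift j N = (?W * (?V * N)\<^sup>T)\<^sup>T" if "N \<in> carrier_mat (j * s) (j * s)" for N
    unfolding lift_def using VW that by (subst transpose_mult) auto
  have c: "(?V * N)\<^sup>T \<in> carrier_mat (j * s) n" if "N \<in> carrier_mat (j * s) (j * s)" for N
    using VW that by auto
  have "frob_inner (lift j M) (lift j M') = frob_inner (?W * (?V * M)\<^sup>T) (?W * (?V * M')\<^sup>T)"
    unfolding t[OF M] t[OF M'] using VW c[OF M] c[OF M']
    by (intro frob_inner_transpose) auto
  also have "\<dots> = frob_inner (?V * M)\<^sup>T (?V * M')\<^sup>T"
    using VW(2) W[OF j] c M M' by (intro frob_inner_orthonormal_left) auto
  also have "\<dots> = frob_inner (?V * M) (?V * M')"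
    using VW M M' by (intro frob_inner_transpose) auto
  also have "\<dots> = frob_inner M M'"
    using VW(1) V[OF j] M M' by (intro frob_inner_orthonormal_left) auto
  finally show ?thesis .
qed

lemma frob_inner_lift_pad:
  assumes j: "j + i \<in> {1..J}" and M: "M \<in> carrier_mat (j * s) (j * s)"
    and Y: "Y \<in> carrier_mat ((j + i) * s) ((j + i) * s)"
  shows "frob_inner (lift (j + i) Y) (lift j M) = frob_inner (upper_left (j * s) (j * s) Y) M"
proof -
  have c: "pad (i * s) M \<in> carrier_mat ((j + i) * s) ((j + i) * s)"
    using pad_carrier[OF M] by (simp add: add_mult_distrib)
  have "frob_inner (lift (j + i) Y) (lift j M) = frob_inner Y (pad (i * s) M)"
    using frob_inner_lift[OF j Y c] lift_pad[of j i M] j M by simp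
  then show ?thesis
    using frob_inner_pad[OF M, of Y "i * s"] Y by (simp add: add_mult_distrib)
qed

text \<open>
  \<open>A \<V>\<^sub>j M \<W>\<^sub>j\<^sup>T = \<V>\<^sub>j\<^sub>+\<^sub>1 H M \<W>\<^sub>j\<^sup>T\<close> already uses the larger left basis, and the zero columns
  make up for the missing block on the right. The other term is its mirror image, with
  \<open>\<W>\<^sub>j\<^sup>T B = G\<^sup>T \<W>\<^sub>j\<^sub>+\<^sub>1\<^sup>T\<close> obtained by transposing the relation for \<open>B\<^sup>T\<close>.
\<close>

lemma lift_sylvester:
  assumes A: "A \<in> carrier_mat n n" and B: "B \<in> carrier_mat m m" and j: "Suc j \<le> J"
    and M: "M \<in> carrier_mat (j * s) (j * s)"
    and Hc: "H \<in> carrier_mat (Suc j * s) (j * s)" and Gc: "G \<in> carrier_mat (Suc j * s) (j * s)"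
    and AV: "A * block_row n V j = block_row n V (Suc j) * H"
    and BW: "B\<^sup>T * block_row m W j = block_row m W (Suc j) * G"
  shows "lift (Suc j) (append_cols (H * M) (0\<^sub>m (Suc j * s) s) + (M * G\<^sup>T @\<^sub>r 0\<^sub>m s (Suc j * s)))
      = A * lift j M + lift j M * B"
proof -
  let ?V = "block_row n V" and ?W = "block_row m W"
  have VW: "?V j \<in> carrier_mat n (j * s)" "?W j \<in> carrier_mat m (j * s)"
     "?V (Suc j) \<in> carrier_mat n (Suc j * s)" "?W (Suc j) \<in> carrier_mat m (Suc j * s)"
    using block_row_carrier[of j] block_row_carrier[OF j] j by auto
  have HM: "H * M \<in> carrier_mat (Suc j * s) (j * s)" and MG: "M * G\<^sup>T \<in> carrier_mat (j * s) (Suc j * s)"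
    using M Hc Gc by auto
  have c: "append_cols (H * M) (0\<^sub>m (Suc j * s) s) \<in> carrier_mat (Suc j * s) (Suc j * s)"
    using append_cols_carrier[OF HM zero_carrier_mat[of _ s]] by (simp add: add.commute)
  have d: "M * G\<^sup>T @\<^sub>r 0\<^sub>m s (Suc j * s) \<in> carrier_mat (Suc j * s) (Suc j * s)"
    using carrier_append_rows[OF MG zero_carrier_mat[of s]] by (simp add: add.commute)
  have "?V (Suc j) * (H * M) * (?W j)\<^sup>T = ?V (Suc j) * H * M * (?W j)\<^sup>T"
    using VW M Hc by (simp add: assoc_mult_mat[of "?V (Suc j)" n "Suc j * s" H "j * s" M "j * s"])
  also have "\<dots> = A * ?V j * (M * (?W j)\<^sup>T)"
    unfolding AV[symmetric] using A VW M by (intro assoc_mult_mat) auto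
  also have "\<dots> = A * (?V j * (M * (?W j)\<^sup>T))"
    using A VW M by (intro assoc_mult_mat) auto
  also have "\<dots> = A * lift j M"
    unfolding lift_def using VW M by (subst assoc_mult_mat[of "?V j"]) auto
  finally have left: "?V (Suc j) * (H * M) * (?W j)\<^sup>T = A * lift j M" .
  have GW: "G\<^sup>T * (?W (Suc j))\<^sup>T = (?W j)\<^sup>T * B"
  proof -
    have "G\<^sup>T * (?W (Suc j))\<^sup>T = (?W (Suc j) * G)\<^sup>T"
      using transpose_mult[OF VW(4) Gc] by simp
    also have "\<dots> = (?W j)\<^sup>T * B"
      using transpose_mult[of "B\<^sup>T" m m "?W j" "j * s"] B VW(2) unfolding BW[symmetric] by simp
    finally show ?thesis .
  qed
  have "?V j * (M * G\<^sup>T) * (?W (Suc j))\<^sup>T = ?V j * M * G\<^sup>T * (?W (Suc j))\<^sup>T"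
    using VW M Gc by (subst assoc_mult_mat[of "?V j"]) auto
  also have "\<dots> = ?V j * M * (G\<^sup>T * (?W (Suc j))\<^sup>T)"
    using VW M Gc by (intro assoc_mult_mat) auto
  also have "\<dots> = lift j M * B"
    unfolding GW lift_def using VW M B by (intro assoc_mult_mat[symmetric]) auto
  finally have right: "?V j * (M * G\<^sup>T) * (?W (Suc j))\<^sup>T = lift j M * B" .
  show ?thesis
    unfolding lift_add[OF j c d] lift_append_cols_zero[OF j HM] lift_append_rows_zero[OF j MG]
      left right ..
qed

end

section \<open>The two iterations\<close>

text \<open>
  Most of these equations match any argument, not just \<open>0\<close> or a successor. As rewrite rules
  they would unfold the whole mutual recursion wherever an iterate occurs.
\<close>

declare
  bicg_X.simps[simp del] bicg_R.simps[simp del] bicg_P.simps[simp del] bicg_Q.simps[simp del] bicg_S.simps[simp del] bicg_T.simps[simp del] bicg_alpha.simps[simp del] bicg_omega.simps[simp del] bicg_beta.simps[simp del] bicg_rho.simps[simp del]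
  fact_X.simps[simp del] fact_R.simps[simp del] fact_P.simps[simp del] fact_Q.simps[simp del] fact_S.simps[simp del] fact_T.simps[simp del] fact_alpha.simps[simp del] fact_omega.simps[simp del] fact_beta.simps[simp del] fact_rho.simps[simp del]

locale krylov_bicgstab =
  fixes A B C1 C2 RL RR :: "real mat" and V W H G :: "nat \<Rightarrow> real mat" and n m s N :: nat
  assumes A: "A \<in> carrier_mat n n" and B: "B \<in> carrier_mat m m"
    and krylov_V: "block_krylov n s (2 * N) A C1 V RL H"
    and krylov_W: "block_krylov m s (2 * N) B\<^sup>T C2 W RR G"
begin

sublocale orthonormal_bases n m s "2 * N + 1" V W
  using krylov_V krylov_W unfolding block_krylov_def by unfold_locales blast+

text \<open>
  Plain letters stand for the matrix-oriented iteration; a leading \<open>f\<close> marks the factorized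
  counterpart.
\<close>

abbreviation "X \<equiv> bicg_X A B C1 C2"
abbreviation "R \<equiv> bicg_R A B C1 C2"
abbreviation "P \<equiv> bicg_P A B C1 C2"
abbreviation "Q \<equiv> bicg_Q A B C1 C2"
abbreviation "S \<equiv> bicg_S A B C1 C2"
abbreviation "T \<equiv> bicg_T A B C1 C2"
abbreviation "alpha \<equiv> bicg_alpha A B C1 C2"
abbreviation "omega \<equiv> bicg_omega A B C1 C2"
abbreviation "beta \<equiv> bicg_beta A B C1 C2"
abbreviation "rho \<equiv> bicg_rho A B C1 C2"
abbreviation "Rt \<equiv> bicg_Rt C1 C2"
abbreviation "fX \<equiv> fact_X s RL RR H G"
abbreviation "fR \<equiv> fact_R s RL RR H G"
abbreviation "fP \<equiv> fact_P s RL RR H G"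
abbreviation "fQ \<equiv> fact_Q s RL RR H G"
abbreviation "fS \<equiv> fact_S s RL RR H G"
abbreviation "fT \<equiv> fact_T s RL RR H G"
abbreviation "falpha \<equiv> fact_alpha s RL RR H G"
abbreviation "fomega \<equiv> fact_omega s RL RR H G"
abbreviation "fbeta \<equiv> fact_beta s RL RR H G"
abbreviation "frho \<equiv> fact_rho s RL RR H G"
abbreviation "fRt \<equiv> fact_Rt RL RR"

lemma triangular_factors_carrier: "RL \<in> carrier_mat s s" "RR \<in> carrier_mat s s"
  using krylov_V krylov_W unfolding block_krylov_def by blast+

lemma hessenberg_carrier:
  assumes "j \<in> {1..2 * N}"
  shows "H j \<in> carrier_mat (Suc j * s) (j * s)" "G j \<in> carrier_mat (Suc j * s) (j * s)"
  using krylov_V krylov_W assms unfolding block_krylov_def Suc_eq_plus1 by blast+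

lemma arnoldi_relation:
  assumes "j \<in> {1..2 * N}"
  shows "A * block_row n V j = block_row n V (Suc j) * H j"
    and "B\<^sup>T * block_row m W j = block_row m W (Suc j) * G j"
  using krylov_V krylov_W assms unfolding block_krylov_def Suc_eq_plus1 by blast+

lemma shadow_residual_carrier: "fRt \<in> carrier_mat (1 * s) (1 * s)"
  using triangular_factors_carrier by (simp add: fact_Rt_def)

text \<open>
  The QR factorizations give \<open>C1 C2\<^sup>T = V\<^sub>1 (RL RR\<^sup>T) W\<^sub>1\<^sup>T\<close>, so the shadow residual already
  lies in the first basis block and needs only the leading \<open>s \<times> s\<close> coordinates.
\<close>

lemma shadow_residual_lift: "Rt = lift 1 fRt"
proof -
  have V1: "V 1 \<in> carrier_mat n s" and W1: "W 1 \<in> carrier_mat m s"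
    using V[of 1] W[of 1] by auto
  have C: "C1 = V 1 * RL" "C2 = W 1 * RR"
    using krylov_V krylov_W unfolding block_krylov_def by blast+
  have row1: "block_row d U 1 = U 1" if "U 1 \<in> carrier_mat d s" for d U
    using that unfolding One_nat_def by (intro eq_matI) (auto simp: append_cols_def)
  have "V 1 * RL * (RR\<^sup>T * (W 1)\<^sup>T) = V 1 * (RL * (RR\<^sup>T * (W 1)\<^sup>T))"
    using V1 W1 triangular_factors_carrier by (intro assoc_mult_mat) auto
  also have "RL * (RR\<^sup>T * (W 1)\<^sup>T) = RL * RR\<^sup>T * (W 1)\<^sup>T"
    using W1 triangular_factors_carrier by (intro assoc_mult_mat[symmetric]) auto
  also have "V 1 * \<dots> = V 1 * (RL * RR\<^sup>T) * (W 1)\<^sup>T"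
    using V1 W1 triangular_factors_carrier by (intro assoc_mult_mat[symmetric]) auto
  finally show ?thesis
    unfolding bicg_Rt_def fact_Rt_def lift_def row1[of V, OF V1] row1[of W, OF W1] C
      transpose_mult[OF W1 triangular_factors_carrier(2)] .
qed

lemma sylvester_carrier:
  assumes j: "j \<in> {1..2 * N}" and M: "M \<in> carrier_mat (j * s) (j * s)"
  shows "append_cols (H j * M) (0\<^sub>m (Suc j * s) s) + (M * (G j)\<^sup>T @\<^sub>r 0\<^sub>m s (Suc j * s))
    \<in> carrier_mat (Suc j * s) (Suc j * s)"
proof -
  have "M * (G j)\<^sup>T \<in> carrier_mat (j * s) (Suc j * s)"
    using hessenberg_carrier[OF j] M by auto
  from carrier_append_rows[OF this zero_carrier_mat[of s]] show ?thesis
    by (simp add: add.commute)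
qed

lemma sylvester_lift:
  assumes j: "j \<in> {1..2 * N}" and M: "M \<in> carrier_mat (j * s) (j * s)"
  shows "lift (Suc j) (append_cols (H j * M) (0\<^sub>m (Suc j * s) s) + (M * (G j)\<^sup>T @\<^sub>r 0\<^sub>m s (Suc j * s)))
    = A * lift j M + lift j M * B"
  using j by (intro lift_sylvester A B M hessenberg_carrier[OF j] arnoldi_relation[OF j]) auto

text \<open>
  Both orders of the arguments are needed because the matrix-oriented method has the shadow
  residual on the left in the denominator of \<open>alpha\<close> and on the right in \<open>rho\<close>.
\<close>

lemma inner_shadow_residual:
  assumes j: "j \<in> {1..2 * N + 1}" and M: "M \<in> carrier_mat (j * s) (j * s)"
  shows "frob_inner fRt (upper_left s s M) = frob_inner Rt (lift j M)"
    and "frob_inner fRt (upper_left s s M) = frob_inner (lift j M) Rt"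
proof -
  obtain i where i: "j = 1 + i"
    using j by (auto simp: nat_le_iff_add)
  have "frob_inner (lift j M) Rt = frob_inner (upper_left s s M) fRt"
    using frob_inner_lift_pad[of 1 i fRt M] j M shadow_residual_carrier
    unfolding shadow_residual_lift i by simp
  also have "\<dots> = frob_inner fRt (upper_left s s M)"
    using upper_left_index(1)[OF M, of s s] shadow_residual_carrier i
    by (intro frob_inner_comm[of _ s s]) auto
  finally show *: "frob_inner fRt (upper_left s s M) = frob_inner (lift j M) Rt" ..
  show "frob_inner fRt (upper_left s s M) = frob_inner Rt (lift j M)"
    unfolding * shadow_residual_lift using j M shadow_residual_carrier
    by (intro frob_inner_comm[of _ n m] lift_carrier) auto
qed

text \<open>
  The induction invariant. The dimension is part of it because the algebraic laws of
  \<open>lift\<close> hold only for matrices of matching size.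
\<close>

definition represents :: "nat \<Rightarrow> real mat \<Rightarrow> real mat \<Rightarrow> bool" where
  "represents j M Y \<longleftrightarrow> M \<in> carrier_mat (j * s) (j * s) \<and> Y = lift j M"

lemma represents_add:
  "j \<le> 2 * N + 1 \<Longrightarrow> represents j M Y \<Longrightarrow> represents j M' Y' \<Longrightarrow> represents j (M + M') (Y + Y')"
  unfolding represents_def by (auto simp: lift_add)

lemma represents_minus:
  "j \<le> 2 * N + 1 \<Longrightarrow> represents j M Y \<Longrightarrow> represents j M' Y' \<Longrightarrow> represents j (M - M') (Y - Y')"
  unfolding represents_def by (auto simp: lift_minus)

lemma represents_smult:
  "j \<le> 2 * N + 1 \<Longrightarrow> represents j M Y \<Longrightarrow> represents j (c \<cdot>\<^sub>m M) (c \<cdot>\<^sub>m Y)"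
  unfolding represents_def by (auto simp: lift_smult)

lemma represents_pad:
  assumes "j + i \<le> 2 * N + 1" "represents j M Y"
  shows "represents (j + i) (pad (i * s) M) Y"
  using assms lift_pad[of j i M] pad_carrier[of M "j * s" "j * s" "i * s"]
  unfolding represents_def by (simp add: add_mult_distrib)

lemma represents_sylvester:
  assumes "j \<in> {1..2 * N}" "represents j M Y"
  shows "represents (Suc j)
    (append_cols (H j * M) (0\<^sub>m (Suc j * s) s) + (M * (G j)\<^sup>T @\<^sub>r 0\<^sub>m s (Suc j * s))) (A * Y + Y * B)"
  using assms sylvester_carrier[of j M] sylvester_lift[of j M] unfolding represents_def by simp

text \<open>
  The factorized method does not truncate \<open>R\<^sub>0\<close>, whose size is already \<open>s \<times> s\<close>; the
  initial case is therefore the isometry itself rather than its truncated form.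
\<close>

lemma rho_if_represents:
  assumes k: "k \<le> N" and R: "represents (2 * k + 1) (fR k) (R k)"
  shows "frho k = rho k"
proof (cases k)
  case 0
  have "rho 0 = frob_inner Rt Rt" "frho 0 = frob_inner fRt fRt"
    by (simp_all add: bicg_Rt_def fact_Rt_def bicg_rho.simps bicg_R.simps fact_rho.simps fact_R.simps)
  then show ?thesis
    unfolding 0 shadow_residual_lift using shadow_residual_carrier by (simp add: frob_inner_lift)
next
  case (Suc l)
  have "frho k = frob_inner fRt (upper_left s s (fR k))"
    unfolding Suc by (simp only: fact_rho.simps)
  also have "\<dots> = frob_inner (R k) Rt"
    using inner_shadow_residual(2)[of "2 * k + 1" "fR k"] k R unfolding represents_def by auto
  finally show ?thesis by (simp only: bicg_rho.simps)
qed

lemma represents_initial: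
  "represents 0 (fX 0) (X 0)" "represents 1 (fR 0) (R 0)" "represents 1 (fP 0) (P 0)"
proof -
  show "represents 0 (fX 0) (X 0)"
    using A B by (auto simp: represents_def lift_def bicg_X.simps fact_X.simps intro!: eq_matI)
  show "represents 1 (fR 0) (R 0)"
    using shadow_residual_carrier shadow_residual_lift
    by (simp add: represents_def fact_Rt_def bicg_Rt_def bicg_R.simps fact_R.simps)
  then show "represents 1 (fP 0) (P 0)"
    by (simp add: bicg_P.simps fact_P.simps)
qed

text \<open>
  The conclusions depend on each other in the order in which the algorithm computes them: a new
  matrix needs the scalars in front of its terms to agree, and a new scalar needs the matrices in
  its inner products to correspond.
\<close>

lemma represents_step:
  assumes k: "k < N"
    and X: "represents (2 * k) (fX k) (X k)"
    and R: "represents (2 * k + 1) (fR k) (R k)"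
    and P: "represents (2 * k + 1) (fP k) (P k)"
  shows "represents (2 * k + 2) (fQ k) (Q k)" (is ?Q)
    and "represents (2 * k + 2) (fS k) (S k)" (is ?S)
    and "represents (2 * k + 3) (fT k) (T k)" (is ?T)
    and "represents (2 * Suc k) (fX (Suc k)) (X (Suc k))" (is ?X)
    and "represents (2 * Suc k + 1) (fR (Suc k)) (R (Suc k))" (is ?R)
    and "represents (2 * Suc k + 1) (fP (Suc k)) (P (Suc k))" (is ?P)
    and "frob_inner fRt (upper_left s s (fQ k)) = frob_inner Rt (Q k)" (is ?RQ)
    and "frob_inner (fT k) (fT k) = frob_inner (T k) (T k)" (is ?TT)
    and "falpha k = alpha k" (is ?alpha)
    and "fomega k = omega k" (is ?omega)
    and "fbeta k = beta k" (is ?beta)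
proof -
  have pad1: "represents (Suc j) (pad s M) Y" if "Suc j \<le> 2 * N + 1" "represents j M Y" for j M Y
    using represents_pad[of j 1 M Y] that by simp
  have pad2: "represents (Suc (Suc j)) (pad (2 * s) M) Y"
    if "Suc (Suc j) \<le> 2 * N + 1" "represents j M Y" for j M Y
    using represents_pad[of j 2 M Y] that by simp
  \<comment> \<open>Brings the dimensions of the general lemmas into the form used by the recursion.\<close>
  have e: "Suc (2 * k + 1) = 2 * k + 2" "Suc (2 * k + 2) = 2 * k + 3" "2 * Suc k = 2 * k + 2"
    "Suc (2 * k) = 2 * k + 1" "2 * k + 2 + 1 = 2 * k + 3"
    by simp_all
  have le: "2 * k + 1 \<le> 2 * N + 1" "2 * k + 2 \<le> 2 * N + 1" "2 * k + 3 \<le> 2 * N + 1"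
    using k by simp_all
  have rho: "frho k = rho k"
    using rho_if_represents k R by simp
  show Q: ?Q
    unfolding fact_Q.simps bicg_Q.simps
    using represents_sylvester[OF _ P, unfolded e] k by simp
  show RQ: ?RQ
    using inner_shadow_residual(1)[of "2 * k + 2" "fQ k"] Q k unfolding represents_def by simp
  show alpha: ?alpha
    unfolding fact_alpha.simps bicg_alpha.simps rho RQ ..
  show S: ?S
    unfolding fact_S.simps bicg_S.simps alpha
    using pad1[OF _ R, unfolded e] Q le by (intro represents_minus represents_smult) auto
  show T: ?T
    unfolding fact_T.simps bicg_T.simps
    using represents_sylvester[OF _ S, unfolded e] k by simp
  have TS: "frob_inner (upper_left ((2 * k + 2) * s) ((2 * k + 2) * s) (fT k)) (fS k) = frob_inner (T k) (S k)"
    using frob_inner_lift_pad[of "2 * k + 2" 1 "fS k" "fT k", unfolded e] S T le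
    unfolding represents_def by simp
  show TT: ?TT
    using frob_inner_lift[of "2 * k + 3" "fT k" "fT k"] T le unfolding represents_def by simp
  show omega: ?omega
    unfolding fact_omega.simps bicg_omega.simps TS TT ..
  show ?X
    unfolding fact_X.simps bicg_X.simps alpha omega e
    using pad2[OF _ X, unfolded e] pad1[OF _ represents_smult[OF _ P], unfolded e] S le
    by (intro represents_add represents_smult) auto
  show R': ?R
    unfolding fact_R.simps bicg_R.simps omega e
    using pad1[OF _ S, unfolded e] T le by (intro represents_minus represents_smult) auto
  have "frho (Suc k) = rho (Suc k)"
    using rho_if_represents[OF _ R'] k by simp
  then show beta: ?beta
    unfolding fact_beta.simps bicg_beta.simps by (simp only: alpha omega rho)
  show ?P
    unfolding fact_P.simps bicg_P.simps omega beta e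
    using R'[unfolded e] pad2[OF _ P, unfolded e] pad1[OF _ Q, unfolded e] le
    by (intro represents_add represents_minus represents_smult) auto
qed

lemma represents_XRP:
  assumes "k \<le> N"
  shows "represents (2 * k) (fX k) (X k)"
    and "represents (2 * k + 1) (fR k) (R k)"
    and "represents (2 * k + 1) (fP k) (P k)"
proof -
  from assms have "represents (2 * k) (fX k) (X k) \<and> represents (2 * k + 1) (fR k) (R k)
    \<and> represents (2 * k + 1) (fP k) (P k)"
  proof (induction k)
    case 0
    then show ?case using represents_initial by simp
  next
    case (Suc k)
    then have "k < N" and "represents (2 * k) (fX k) (X k)"
      "represents (2 * k + 1) (fR k) (R k)" "represents (2 * k + 1) (fP k) (P k)"
      by auto
    from represents_step(4-6)[OF this] show ?case by blast
  qed
  then show "represents (2 * k) (fX k) (X k)" "represents (2 * k + 1) (fR k) (R k)"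
    "represents (2 * k + 1) (fP k) (P k)"
    by blast+
qed

lemma same_rho: "k \<le> N \<Longrightarrow> frho k = rho k"
  by (intro rho_if_represents represents_XRP)

context
  fixes k :: nat
  assumes k: "k < N"
begin

lemmas step = represents_step[OF k represents_XRP[OF less_imp_le[OF k]]]

lemma represents_QST:
  "represents (2 * k + 2) (fQ k) (Q k)"
  "represents (2 * k + 2) (fS k) (S k)"
  "represents (2 * k + 3) (fT k) (T k)"
  by (fact step)+

lemma same_denominators:
  "frob_inner fRt (upper_left s s (fQ k)) = frob_inner Rt (Q k)"
  "frob_inner (fT k) (fT k) = frob_inner (T k) (T k)"
  by (fact step)+

lemma same_scalars: "falpha k = alpha k" "fomega k = omega k" "fbeta k = beta k"
  by (fact step)+

end

lemma no_breakdown_transfer: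
  assumes "bicg_no_breakdown A B C1 C2 N"
  shows "fact_no_breakdown s RL RR H G N"
  using assms unfolding bicg_no_breakdown_def fact_no_breakdown_def
  by (simp add: same_denominators same_scalars same_rho)

lemma frob_norm_residual:
  assumes "k \<le> N"
  shows "frob_norm (R k) = frob_norm (fR k)"
  using represents_XRP(2)[OF assms] assms frob_inner_lift[of "2 * k + 1" "fR k" "fR k"]
  unfolding represents_def frob_norm_def by simp

end

theorem mainTheorem5:
  fixes A B C1 C2 RL RR :: "real mat"
    and V W H G :: "nat \<Rightarrow> real mat"
    and n m s N :: nat
  assumes "A \<in> carrier_mat n n" and "B \<in> carrier_mat m m"
    and "C1 \<in> carrier_mat n s" and "C2 \<in> carrier_mat m s"
    and "N \<ge> 1"
    and "block_krylov n s (2 * N) A C1 V RL H"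
    and "block_krylov m s (2 * N) B\<^sup>T C2 W RR G"
    and "bicg_no_breakdown A B C1 C2 N"
  shows "fact_no_breakdown s RL RR H G N \<and>
    (\<forall>k<N. fact_alpha s RL RR H G k = bicg_alpha A B C1 C2 k \<and>
           fact_omega s RL RR H G k = bicg_omega A B C1 C2 k \<and>
           fact_beta s RL RR H G k = bicg_beta A B C1 C2 k) \<and>
    (\<forall>k\<le>N. fact_rho s RL RR H G k = bicg_rho A B C1 C2 k) \<and>
    bicg_X A B C1 C2 0 = 0\<^sub>m n m \<and>
    (\<forall>k\<in>{1..N}. bicg_X A B C1 C2 k
        = block_row n V (2 * k) * fact_X s RL RR H G k * (block_row m W (2 * k))\<^sup>T) \<and>
    (\<forall>k\<le>N.
        bicg_R A B C1 C2 k
          = block_row n V (2 * k + 1) * fact_R s RL RR H G k * (block_row m W (2 * k + 1))\<^sup>T \<and>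
        bicg_P A B C1 C2 k
          = block_row n V (2 * k + 1) * fact_P s RL RR H G k * (block_row m W (2 * k + 1))\<^sup>T) \<and>
    (\<forall>k<N.
        bicg_Q A B C1 C2 k
          = block_row n V (2 * k + 2) * fact_Q s RL RR H G k * (block_row m W (2 * k + 2))\<^sup>T \<and>
        bicg_S A B C1 C2 k
          = block_row n V (2 * k + 2) * fact_S s RL RR H G k * (block_row m W (2 * k + 2))\<^sup>T \<and>
        bicg_T A B C1 C2 k
          = block_row n V (2 * k + 3) * fact_T s RL RR H G k * (block_row m W (2 * k + 3))\<^sup>T) \<and>
    (\<forall>k\<le>N.
        frob_norm (bicg_R A B C1 C2 k) = frob_norm (fact_R s RL RR H G k) \<and>
        frob_norm (bicg_R A B C1 C2 k) / frob_norm (bicg_R A B C1 C2 0)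
          = frob_norm (fact_R s RL RR H G k) / frob_norm (fact_R s RL RR H G 0))"
proof -
  interpret krylov_bicgstab A B C1 C2 RL RR V W H G n m s N
    using assms(1,2,6,7) by unfold_locales
  have "\<forall>k<N. falpha k = alpha k \<and> fomega k = omega k \<and> fbeta k = beta k"
    using same_scalars by blast
  moreover have "\<forall>k\<le>N. frho k = rho k"
    using same_rho by blast
  moreover have "X 0 = 0\<^sub>m n m"
    using assms(1,2) by (simp add: bicg_X.simps)
  moreover have "\<forall>k\<in>{1..N}. X k = block_row n V (2 * k) * fX k * (block_row m W (2 * k))\<^sup>T"
    using represents_XRP(1) unfolding represents_def lift_def by simp
  moreover have "\<forall>k\<le>N.
      R k = block_row n V (2 * k + 1) * fR k * (block_row m W (2 * k + 1))\<^sup>T \<and>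
      P k = block_row n V (2 * k + 1) * fP k * (block_row m W (2 * k + 1))\<^sup>T"
    using represents_XRP(2,3) unfolding represents_def lift_def by blast
  moreover have "\<forall>k<N.
      Q k = block_row n V (2 * k + 2) * fQ k * (block_row m W (2 * k + 2))\<^sup>T \<and>
      S k = block_row n V (2 * k + 2) * fS k * (block_row m W (2 * k + 2))\<^sup>T \<and>
      T k = block_row n V (2 * k + 3) * fT k * (block_row m W (2 * k + 3))\<^sup>T"
    using represents_QST unfolding represents_def lift_def by blast
  moreover have "\<forall>k\<le>N. frob_norm (R k) = frob_norm (fR k) \<and>
      frob_norm (R k) / frob_norm (R 0) = frob_norm (fR k) / frob_norm (fR 0)"
    using frob_norm_residual by simp
  ultimately show ?thesis
    using no_breakdown_transfer[OF assms(8)] by blast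
qed

end
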